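(* Let $q>2$ be a prime power, $m\ge 3$ an integer, and $f:\mathbb{F}_q^m\to\mathbb{F}_q$ a function satisfying the following two conditions: (1) if $1\le\mathrm{wt}(\mathbf{x})\le 2$, then for any $a\in\mathbb{F}_q^*$, $f(a\mathbf{x})=f(\mathbf{x})\neq 0$; (2) if $\mathrm{wt}(\mathbf{x})=m$, then $f(\mathbf{x})=0$. Then the linear code $\mathcal{C}_f$ is minimal.
   Context: $\mathrm{wt}(\mathbf{x})$ is the Hamming weight (number of nonzero coordinates) of $\mathbf{x}\in\mathbb{F}_q^m$, and $\mathbf{x}\cdot\mathbf{y}=\sum_i x_iy_i$. For $f:\mathbb{F}_q^m\to\mathbb{F}_q$, $\mathcal{C}_f=\{(uf(\mathbf{x})+\mathbf{v}\cdot\mathbf{x})_{\mathbf{x}\in\mathbb{F}_q^m\setminus\{\mathbf{0}\}} : u\in\mathbb{F}_q,\ \mathbf{v}\in\mathbb{F}_q^m\}\subseteq\mathbb{F}_q^{q^m-1}$. The support of a vector is the set of its coordinate positions with nonzero entry. A codeword $\mathbf{c}$ of a linear code $\mathcal{C}$ is minimal if every $\mathbf{b}\in\mathcal{C}$ whose support is contained in the support of $\mathbf{c}$ equals $a\mathbf{c}$ for some $a\in\mathbb{F}_q$; the code $\mathcal{C}$ is minimal if all of its codewords are minimal. *)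

theory Defs
  imports "HOL-Analysis.Analysis"
begin

(* A finite field F_q is a type 'a of class {field, finite} with q = CARD('a) (necessarily a
   prime power), and F_q^m is the type 'a ^ 'm with m = CARD('m). *)

definition supp :: "'a::zero ^ 'i \<Rightarrow> 'i set" where
  "supp x = {i. x $ i \<noteq> 0}"

definition wt :: "'a::zero ^ 'i \<Rightarrow> nat" where
  "wt x = card (supp x)"

definition dot :: "'a::comm_semiring_1 ^ 'm \<Rightarrow> 'a ^ 'm \<Rightarrow> 'a" where
  "dot x y = (\<Sum>i\<in>UNIV. x $ i * y $ i)"

(* A code of length n is a set of vectors over an index type with n elements. *)

definition linear_code :: "('a::field ^ 'i) set \<Rightarrow> bool" where
  "linear_code C \<longleftrightarrow> vec.subspace C"

definition minimal_codeword :: "('a::field ^ 'i) set \<Rightarrow> 'a ^ 'i \<Rightarrow> bool" where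
  "minimal_codeword C c \<longleftrightarrow> c \<in> C \<and> (\<forall>b\<in>C. supp b \<subseteq> supp c \<longrightarrow> (\<exists>a. b = a *s c))"

definition minimal_code :: "('a::field ^ 'i) set \<Rightarrow> bool" where
  "minimal_code C \<longleftrightarrow> (\<forall>c\<in>C. minimal_codeword C c)"

(* The coordinate positions of the code of f: the nonzero vectors of F_q^m. *)

typedef (overloaded) ('a, 'm) nonzero_vec = "{x :: 'a::zero_neq_one ^ 'm. x \<noteq> 0}"
  morphisms vec_of Nonzero_vec
proof
  show "(\<chi> i. 1) \<in> {x :: 'a ^ 'm. x \<noteq> 0}"
    by (simp add: vec_eq_iff)
qed

instance nonzero_vec :: ("{finite, zero_neq_one}", finite) finite
proof
  have "inj (vec_of :: ('a, 'b) nonzero_vec \<Rightarrow> 'a ^ 'b)"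
    by (simp add: inj_def vec_of_inject)
  then show "finite (UNIV :: ('a, 'b) nonzero_vec set)"
    by (rule finite_imageD[rotated]) simp
qed

lemma card_nonzero_vec:
  "CARD(('a::{finite, zero_neq_one}, 'm::finite) nonzero_vec) = CARD('a) ^ CARD('m) - 1"
proof -
  interpret type_definition vec_of Nonzero_vec "{x :: 'a ^ 'm. x \<noteq> 0}"
    by (rule type_definition_nonzero_vec)
  have "{x :: 'a ^ 'm. x \<noteq> 0} = UNIV - {0}"
    by auto
  then show ?thesis
    using card by simp
qed

definition code_word ::
  "('a::{field, finite} ^ 'm \<Rightarrow> 'a) \<Rightarrow> 'a \<Rightarrow> 'a ^ 'm \<Rightarrow> 'a ^ ('a, 'm) nonzero_vec" where
  "code_word f u v = (\<chi> x. u * f (vec_of x) + dot v (vec_of x))"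

definition code_of ::
  "('a::{field, finite} ^ 'm \<Rightarrow> 'a) \<Rightarrow> ('a ^ ('a, 'm) nonzero_vec) set" where
  "code_of f = {code_word f u v | u v. True}"

lemma linear_code_code_of:
  fixes f :: "'a::{field, finite} ^ 'm::finite \<Rightarrow> 'a"
  shows "linear_code (code_of f)"
proof -
  have zero: "0 = code_word f 0 0"
    by (simp add: code_word_def dot_def vec_eq_iff)
  have add: "code_word f u v + code_word f u' v' = code_word f (u + u') (v + v')" for u v u' v'
    by (simp add: code_word_def dot_def vec_eq_iff algebra_simps sum.distrib)
  have scale: "a *s code_word f u v = code_word f (a * u) (a *s v)" for a u v
    by (simp add: code_word_def dot_def vec_eq_iff algebra_simps sum_distrib_left)
  show ?thesis
    unfolding linear_code_def
  proof (rule vec.subspaceI)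
    show "0 \<in> code_of f"
      using zero by (auto simp: code_of_def)
  next
    fix x y assume "x \<in> code_of f" "y \<in> code_of f"
    then show "x + y \<in> code_of f"
      using add by (fastforce simp: code_of_def)
  next
    fix a x assume "x \<in> code_of f"
    then show "a *s x \<in> code_of f"
      using scale by (fastforce simp: code_of_def)
  qed
qed

end

theory Submission
  imports Defs
begin

text \<open>
  Let \<open>c = (u f(x) + v \<cdot> x)\<close> and \<open>b = (u' f(x) + v' \<cdot> x)\<close> with \<open>supp b \<subseteq> supp c\<close>.

  If \<open>u = 0\<close> and \<open>v\<^sub>i \<noteq> 0\<close>, the vectors \<open>x = v\<^sub>i e\<^sub>j - v\<^sub>j e\<^sub>i\<close> have weight 1 or 2 and lie on the
  hyperplane \<open>v \<cdot> x = 0\<close>. Hence \<open>b\<close> vanishes at all nonzero multiples of \<open>x\<close>; as \<open>f\<close> is constant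
  there and \<open>q > 2\<close>, this forces \<open>u' = 0\<close> and \<open>v' \<cdot> x = 0\<close>, so \<open>v'\<close> is a multiple of \<open>v\<close>.

  If \<open>u \<noteq> 0\<close>, subtract \<open>(u'/u) c\<close> from \<open>b\<close> to reach \<open>b = (w \<cdot> x)\<close>; it remains to see \<open>w = 0\<close>.
  If \<open>v = 0\<close>, then \<open>w\<close> is orthogonal to all vectors of full weight, and these span. If \<open>v \<noteq> 0\<close>,
  every \<open>x\<close> of weight 1 or 2 with \<open>v \<cdot> x \<noteq> 0\<close> has a nonzero multiple at which \<open>c\<close> vanishes, so
  \<open>w \<cdot> x = 0\<close>, and such \<open>x\<close> span.
\<close>

lemma dot_add_right: "dot v (x + y) = dot v x + dot v y"
  by (simp add: dot_def distrib_left sum.distrib)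

lemma dot_diff_left: "dot (v - w) x = dot v x - dot w x"
  for v :: "'a::comm_ring_1 ^ 'm"
  by (simp add: dot_def left_diff_distrib sum_subtractf)

lemma dot_scale_left: "dot (a *s v) x = a * dot v x"
  by (simp add: dot_def sum_distrib_left mult_ac)

lemma dot_scale_right: "dot v (a *s x) = a * dot v x"
  by (simp add: dot_def sum_distrib_left mult_ac)

lemma dot_zero_left: "dot 0 x = 0"
  by (simp add: dot_def)

lemma dot_zero_right: "dot v 0 = 0"
  by (simp add: dot_def)

lemma dot_axis_right: "dot v (axis i a) = v $ i * a"
  for v :: "'a::comm_semiring_1 ^ 'm::finite"
proof -
  have "dot v (axis i a) = (\<Sum>k\<in>UNIV. if k = i then v $ k * a else 0)"
    unfolding dot_def by (intro sum.cong) (auto simp: axis_def)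
  then show ?thesis
    by simp
qed

lemmas dot_simps = dot_add_right dot_diff_left dot_scale_left dot_scale_right
  dot_zero_left dot_zero_right dot_axis_right

lemma wt_zero: "wt 0 = 0"
  by (simp add: wt_def supp_def)

lemma wt_axis: "wt (axis i a) = 1" if "a \<noteq> 0"
proof -
  have "supp (axis i a) = {i}"
    using that by (auto simp: supp_def axis_def)
  then show ?thesis
    by (simp add: wt_def)
qed

text \<open>The entry \<open>a\<close> may be 0, giving weight 1: in the application it is
  \<open>- v $ j\<close>, which can vanish.\<close>

lemma wt_axis_add_axis:
  fixes a b :: "'a::comm_ring_1"
  assumes "i \<noteq> j" "b \<noteq> 0"
  shows "1 \<le> wt (axis i a + axis j b)" "wt (axis i a + axis j b) \<le> 2"
proof -
  have sub: "supp (axis i a + axis j b) \<subseteq> {i, j}"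
    by (auto simp: supp_def axis_def)
  have "j \<in> supp (axis i a + axis j b)"
    using assms by (auto simp: supp_def axis_def)
  with sub show "1 \<le> wt (axis i a + axis j b)"
    unfolding wt_def by (auto simp: Suc_le_eq card_gt_0_iff intro: finite_subset)
  have "wt (axis i a + axis j b) \<le> card {i, j}"
    unfolding wt_def by (rule card_mono[OF _ sub]) simp
  also have "\<dots> \<le> 2"
    using assms by simp
  finally show "wt (axis i a + axis j b) \<le> 2" .
qed

lemma wt_full_iff: "wt x = CARD('m) \<longleftrightarrow> (\<forall>i. x $ i \<noteq> 0)"
  for x :: "'a::zero ^ 'm::finite"
proof
  assume "wt x = CARD('m)"
  then have "supp x = UNIV"
    unfolding wt_def by (intro card_subset_eq) auto
  then show "\<forall>i. x $ i \<noteq> 0"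
    by (auto simp: supp_def)
next
  assume "\<forall>i. x $ i \<noteq> 0"
  then show "wt x = CARD('m)"
    by (simp add: wt_def supp_def)
qed

lemma exists_third_element:
  assumes "CARD('a::{zero_neq_one, finite}) > 2"
  obtains t :: "'a::{zero_neq_one, finite}" where "t \<noteq> 0" "t \<noteq> 1"
proof -
  have "card {0, 1 :: 'a} < CARD('a)"
    using assms by simp
  then have "{0, 1 :: 'a} \<noteq> UNIV"
    by (metis nat_neq_iff)
  then show ?thesis
    using that by auto
qed

lemma code_word_scale: "a *s code_word f u v = code_word f (a * u) (a *s v)"
  by (simp add: code_word_def vec_eq_iff dot_scale_left distrib_left mult.assoc)

lemma code_word_diff_scale:
  "code_word f u' v' - a *s code_word f u v = code_word f (u' - a * u) (v' - a *s v)"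
  by (simp add: code_word_def vec_eq_iff dot_diff_left dot_scale_left algebra_simps)

lemma supp_code_word_subset_iff:
  "supp (code_word f u' v') \<subseteq> supp (code_word f u v) \<longleftrightarrow>
    (\<forall>x. x \<noteq> 0 \<longrightarrow> u * f x + dot v x = 0 \<longrightarrow> u' * f x + dot v' x = 0)"
proof -
  have "(\<forall>y. P (vec_of y)) \<longleftrightarrow> (\<forall>x. x \<noteq> 0 \<longrightarrow> P x)" for P :: "'a ^ 'b \<Rightarrow> bool"
    by (metis (mono_tags) Nonzero_vec_inverse mem_Collect_eq vec_of)
  from this[of "\<lambda>x. u * f x + dot v x = 0 \<longrightarrow> u' * f x + dot v' x = 0"] show ?thesis
    by (auto simp: supp_def code_word_def)
qed

text \<open>Two full-weight vectors can differ in a single coordinate once the field has two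
  distinct nonzero elements; their difference isolates \<open>w $ i\<close>.\<close>

lemma eq_0_of_orthogonal_full_wt:
  fixes w :: "'a::{field, finite} ^ 'm::finite"
  assumes q: "CARD('a) > 2"
    and orth: "\<And>x. wt x = CARD('m) \<Longrightarrow> dot w x = 0"
  shows "w = 0"
proof -
  obtain t :: 'a where t: "t \<noteq> 0" "t \<noteq> 1"
    using q by (rule exists_third_element)
  have "w $ i = 0" for i
  proof -
    let ?x = "(\<chi> k. 1) :: 'a ^ 'm"
    \<comment> \<open>The second vector has \<open>t\<close> at position \<open>i\<close> and 1
      elsewhere, so it too has full weight.\<close>
    have "dot w ?x = 0" "dot w (?x + axis i (t - 1)) = 0"
      by (rule orth, use t in \<open>simp add: wt_full_iff axis_def\<close>)+
    then have "w $ i * (t - 1) = 0"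
      by (simp add: dot_simps)
    then show ?thesis
      using t by simp
  qed
  then show ?thesis
    by (simp add: vec_eq_iff)
qed

text \<open>Fix \<open>i\<close> with \<open>v $ i\<close> nonzero. The unit vectors at the support
  of \<open>v\<close>, and the sums of the \<open>i\<close>-th and \<open>j\<close>-th unit vectors
  for \<open>j\<close> off the support, all avoid the hyperplane of \<open>v\<close> and span the
  space.\<close>

lemma eq_0_of_orthogonal_low_wt:
  fixes v w :: "'a::field ^ 'm::finite"
  assumes "v \<noteq> 0"
    and orth: "\<And>x. 1 \<le> wt x \<Longrightarrow> wt x \<le> 2 \<Longrightarrow> dot v x \<noteq> 0 \<Longrightarrow> dot w x = 0"
  shows "w = 0"
proof -
  obtain i where i: "v $ i \<noteq> 0"
    using \<open>v \<noteq> 0\<close> by (auto simp: vec_eq_iff)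
  have diag: "w $ k = 0" if "v $ k \<noteq> 0" for k
    using orth[of "axis k 1"] that by (simp add: wt_axis dot_simps)
  have "w $ j = 0" for j
  proof (cases "v $ j = 0")
    case True
    then have "i \<noteq> j"
      using i by auto
    then show ?thesis
      using orth[of "axis i 1 + axis j 1"] wt_axis_add_axis[of i j 1 1] i True diag[OF i]
      by (simp add: dot_simps)
  qed (rule diag)
  then show ?thesis
    by (simp add: vec_eq_iff)
qed

locale low_weight_scaling =
  fixes f :: "'a::{field, finite} ^ 'm::finite \<Rightarrow> 'a"
  assumes q: "CARD('a) > 2"
    and f_scale: "\<And>x a. 1 \<le> wt x \<Longrightarrow> wt x \<le> 2 \<Longrightarrow> a \<noteq> 0 \<Longrightarrow> f (a *s x) = f x"
    and f_nz: "\<And>x. 1 \<le> wt x \<Longrightarrow> wt x \<le> 2 \<Longrightarrow> f x \<noteq> 0"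
begin

lemma linear_supp_dominates:
  assumes m: "CARD('m) > 1" and "v \<noteq> 0"
    and sub: "supp (code_word f u' v') \<subseteq> supp (code_word f 0 v)"
  shows "\<exists>a. code_word f u' v' = a *s code_word f 0 v"
proof -
  obtain t :: 'a where t: "t \<noteq> 0" "t \<noteq> 1"
    using q by (rule exists_third_element)
  obtain i where i: "v $ i \<noteq> 0"
    using \<open>v \<noteq> 0\<close> by (auto simp: vec_eq_iff)
  have key: "u' = 0 \<and> v' $ j * v $ i = v' $ i * v $ j" if "j \<noteq> i" for j
  proof -
    let ?x = "axis i (- v $ j) + axis j (v $ i)"
    have wt: "1 \<le> wt ?x" "wt ?x \<le> 2"
      using wt_axis_add_axis[of i j "v $ i" "- v $ j"] that i by auto
    then have "?x \<noteq> 0"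
      by (metis wt_zero not_one_le_zero)
    have vanish: "u' * f ?x + a * dot v' ?x = 0" if "a \<noteq> 0" for a
    proof -
      have "a *s ?x \<noteq> 0"
        using \<open>?x \<noteq> 0\<close> that by (simp add: vec.scale_eq_0_iff del: vector_add_ldistrib)
      moreover have "dot v (a *s ?x) = 0"
        by (simp only: dot_simps) simp
      ultimately have "u' * f (a *s ?x) + dot v' (a *s ?x) = 0"
        using sub unfolding supp_code_word_subset_iff by simp
      then show ?thesis
        using f_scale[OF wt that] by (simp only: dot_scale_right)
    qed
    \<comment> \<open>Comparing the multiples by \<open>t\<close> and by 1 cancels the term in
      \<open>f\<close>.\<close>
    have "(t - 1) * dot v' ?x = (u' * f ?x + t * dot v' ?x) - (u' * f ?x + 1 * dot v' ?x)"
      by (simp only: left_diff_distrib add_diff_cancel_left)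
    then have "(t - 1) * dot v' ?x = 0"
      by (simp only: vanish[OF t(1)] vanish[OF one_neq_zero] diff_self)
    then have dot0: "dot v' ?x = 0"
      using t by simp
    moreover have "u' = 0"
      using vanish[of 1] f_nz[OF wt] dot0 by simp
    ultimately show ?thesis
      by (simp add: dot_simps)
  qed
  \<comment> \<open>A second coordinate is required for \<open>key\<close> to yield
    \<open>u' = 0\<close>.\<close>
  obtain j where "j \<noteq> i"
  proof -
    have "card {i} < CARD('m)"
      using m by simp
    then have "{i} \<noteq> UNIV"
      by (metis nat_neq_iff)
    then show ?thesis
      using that by auto
  qed
  then have "u' = 0"
    using key by blast
  moreover have "v' = (v' $ i / v $ i) *s v"
  proof -
    have "v' $ j * v $ i = v' $ i * v $ j" for j
      using key by (cases "j = i") auto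
    then show ?thesis
      using i by (simp add: vec_eq_iff field_simps)
  qed
  ultimately have "code_word f u' v' = (v' $ i / v $ i) *s code_word f 0 v"
    by (metis code_word_scale mult_zero_right)
  then show ?thesis ..
qed

lemma nonlinear_supp_dominates:
  assumes f_full: "\<And>x. wt x = CARD('m) \<Longrightarrow> f x = 0" and "u \<noteq> 0"
    and sub: "supp (code_word f u' v') \<subseteq> supp (code_word f u v)"
  shows "\<exists>a. code_word f u' v' = a *s code_word f u v"
proof -
  \<comment> \<open>This multiple of \<open>v\<close> is the one for which subtracting
    \<open>u' / u\<close> times the larger word cancels \<open>f\<close>; the remainder is the
    linear form of \<open>w\<close>.\<close>
  define w where "w = v' - (u' / u) *s v"
  have orth: "dot w x = 0" if "x \<noteq> 0" "u * f x + dot v x = 0" for x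
  proof -
    have "u' * f x + dot v' x = 0"
      using sub that unfolding supp_code_word_subset_iff by blast
    moreover have "dot w x = (u' * f x + dot v' x) - (u' / u) * (u * f x + dot v x)"
      using \<open>u \<noteq> 0\<close> by (simp add: w_def dot_simps field_simps)
    ultimately show ?thesis
      using that by simp
  qed
  have "w = 0"
  proof (cases "v = 0")
    case True
    show ?thesis
    proof (rule eq_0_of_orthogonal_full_wt[OF q])
      fix x :: "'a ^ 'm"
      assume "wt x = CARD('m)"
      then show "dot w x = 0"
        using orth[of x] f_full[of x] True by (cases "x = 0") (auto simp: dot_simps)
    qed
  next
    case False
    then show ?thesis
    proof (rule eq_0_of_orthogonal_low_wt)
      fix x :: "'a ^ 'm"
      assume wt: "1 \<le> wt x" "wt x \<le> 2" and nz: "dot v x \<noteq> 0"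
      \<comment> \<open>Since \<open>f\<close> is constant on the nonzero multiples of
        \<open>x\<close>, this is the solution of \<open>u * f x + a * dot v x = 0\<close>; it is
        nonzero because \<open>f x\<close> is.\<close>
      define a where "a = - (u * f x) / dot v x"
      have a: "a \<noteq> 0"
        using f_nz[OF wt] nz \<open>u \<noteq> 0\<close> by (simp add: a_def)
      have "x \<noteq> 0"
        using wt by (auto simp: wt_zero)
      moreover have "u * f (a *s x) + dot v (a *s x) = 0"
        unfolding f_scale[OF wt a] dot_scale_right using nz by (simp add: a_def)
      ultimately have "dot w (a *s x) = 0"
        using a by (intro orth) auto
      then show "dot w x = 0"
        using a by (simp add: dot_simps)
    qed
  qed
  then have "code_word f u' v' - (u' / u) *s code_word f u v = code_word f 0 0"
    using \<open>u \<noteq> 0\<close> by (simp add: code_word_diff_scale w_def)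
  then have "code_word f u' v' = (u' / u) *s code_word f u v"
    by (simp add: code_word_def vec_eq_iff dot_simps)
  then show ?thesis ..
qed

end

theorem theorem4p4:
  fixes f :: "'a::{field, finite} ^ 'm::finite \<Rightarrow> 'a"
  assumes "CARD('a) > 2"
    and "CARD('m) \<ge> 3"
    and "\<And>x a. 1 \<le> wt x \<Longrightarrow> wt x \<le> 2 \<Longrightarrow> a \<noteq> 0 \<Longrightarrow> f (a *s x) = f x \<and> f x \<noteq> 0"
    and "\<And>x. wt x = CARD('m) \<Longrightarrow> f x = 0"
  shows "linear_code (code_of f) \<and> minimal_code (code_of f)"
proof
  interpret low_weight_scaling f
  proof
    show "CARD('a) > 2"
      by (rule assms(1))
  qed (use assms(3) one_neq_zero in blast)+
  have "\<exists>a. code_word f u' v' = a *s code_word f u v"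
    if sub: "supp (code_word f u' v') \<subseteq> supp (code_word f u v)" for u v u' v'
  proof -
    consider "u \<noteq> 0" | "u = 0" "v \<noteq> 0" | "u = 0" "v = 0"
      by blast
    then show ?thesis
    proof cases
      case 1
      then show ?thesis
        using nonlinear_supp_dominates assms(4) sub by blast
    next
      case 2
      then show ?thesis
        using linear_supp_dominates assms(2) sub by simp
    next
      case 3
      \<comment> \<open>The zero word has empty support, so the dominated word is zero as
        well.\<close>
      have "code_word f u v = 0"
        by (simp add: 3 code_word_def vec_eq_iff dot_zero_left)
      then have "code_word f u' v' = code_word f u v"
        using sub by (auto simp: supp_def vec_eq_iff)
      then show ?thesis
        by (intro exI[of _ 1]) simp
    qed
  qed
  then show "minimal_code (code_of f)"
    unfolding minimal_code_def minimal_codeword_def code_of_def by blast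
qed (rule linear_code_code_of)

end
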